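(* Let $X$ be an infinite Hausdorff space. The following are equivalent: (i) $\mathcal P_{\mathrm{fin}}(X)$ is Hurewicz. (ii) $\mathcal P_{\mathrm{fin}}(X)\models\mathsf S_{\mathrm{fin}}(\Omega,\Omega^{\mathrm{gp}})$. (iii) $X\models\mathsf S_{\mathrm{fin}}(\Omega,\Omega^{\mathrm{gp}})$. (iv) Every finite power of $X$ is Hurewicz. (v) One does not have a winning strategy in $\mathsf G_{\mathrm{fin}}(\Omega_X,\Omega_X^{\mathrm{gp}})$.
   Context: For a set $Y$, $[Y]^{<\omega}$ is the set of non-empty finite subsets of $Y$. For a space $Z$, $\mathscr T_Z$ is the set of open $U\subseteq Z$ with $U\neq\emptyset$ and $U\neq Z$; $\mathcal O_Z$ is the set of all $\mathscr U\subseteq\mathscr T_Z$ with $\bigcup\mathscr U=Z$; $\Omega_Z$ (the $\omega$-covers) is the set of all $\mathscr U\in\mathcal O_Z$ such that every $F\in[Z]^{<\omega}$ is contained in some $U\in\mathscr U$. $\mathcal P_{\mathrm{fin}}(X)$ is the set $[X]^{<\omega}$ with the subspace topology inherited from the space of non-empty compact subsets of $X$ with the Vietoris topology (generated by the sets $\{K:K\subseteq U\}$ and $\{K:K\cap U\neq\emptyset\}$ for $U\subseteq X$ open). $Z$ is Hurewicz if for every sequence $\langle\mathscr U_n:n\in\omega\rangle$ in $\mathcal O_Z$ there are $\mathscr F_n\in[\mathscr U_n]^{<\omega}$ such that for every $z\in Z$ there is $m$ with $z\in\bigcup\mathscr F_n$ for all $n\geq m$. For a class $\mathfrak C$, $\mathscr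 C\in\mathfrak C$ is groupable if there is $\phi:\mathscr C\to\omega$ with every $\phi^{-1}(n)$ finite and with $\bigcup\{\phi^{-1}(n):n\in J\}\in\mathfrak C$ for every infinite $J\subseteq\omega$; $\mathfrak C^{\mathrm{gp}}$ is the set of groupable members of $\mathfrak C$. $\mathsf S_{\mathrm{fin}}(\mathcal A,\mathcal B)$: for every sequence $\langle\mathscr U_n:n\in\omega\rangle$ in $\mathcal A$ there are $\mathscr F_n\in[\mathscr U_n]^{<\omega}$ with $\bigcup_n\mathscr F_n\in\mathcal B$. $Z\models\mathsf S_{\mathrm{fin}}(\Omega,\Omega^{\mathrm{gp}})$ means $\mathsf S_{\mathrm{fin}}(\Omega_Z,\Omega_Z^{\mathrm{gp}})$ holds. In the game $\mathsf G_{\mathrm{fin}}(\mathcal A,\mathcal B)$, in inning $n\in\omega$ One plays $A_n\in\mathcal A$ and Two responds with $\mathscr F_n\in[A_n]^{<\omega}$; Two wins if $\bigcup_n\mathscr F_n\in\mathcal B$, otherwise One wins. A strategy for One is a function $\sigma$ from finite sequences of Two's moves to $\mathcal A$; it is winning if for every sequence with $\mathscr F_n\in[\sigma(\langle\mathscr F_k:k<n\rangle)]^{<\omega}$ for all $n$, $\bigcup_n\mathscr F_n\notin\mathcal B$. *)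

theory Defs
  imports "HOL-Analysis.Analysis"
begin

definition nonempty_finite_subsets :: "'a set \<Rightarrow> 'a set set" where
  "nonempty_finite_subsets Y = {F. F \<subseteq> Y \<and> finite F \<and> F \<noteq> {}}"

definition nontrivial_opens :: "'a topology \<Rightarrow> 'a set set" where
  "nontrivial_opens Z = {U. openin Z U \<and> U \<noteq> {} \<and> U \<noteq> topspace Z}"

definition open_covers :: "'a topology \<Rightarrow> 'a set set set" where
  "open_covers Z = {\<U>. \<U> \<subseteq> nontrivial_opens Z \<and> \<Union>\<U> = topspace Z}"

definition omega_covers :: "'a topology \<Rightarrow> 'a set set set" where
  "omega_covers Z =
    {\<U> \<in> open_covers Z. \<forall>F \<in> nonempty_finite_subsets (topspace Z). \<exists>U\<in>\<U>. F \<subseteq> U}"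

definition groupable :: "'a set set \<Rightarrow> 'a set set" where
  "groupable \<CC> =
    {\<C> \<in> \<CC>. \<exists>\<phi> :: 'a \<Rightarrow> nat.
       (\<forall>n. finite {C \<in> \<C>. \<phi> C = n}) \<and>
       (\<forall>J. infinite J \<longrightarrow> (\<Union>n\<in>J. {C \<in> \<C>. \<phi> C = n}) \<in> \<CC>)}"

definition Hurewicz :: "'a topology \<Rightarrow> bool" where
  "Hurewicz Z \<longleftrightarrow>
    (\<forall>\<U> :: nat \<Rightarrow> 'a set set. (\<forall>n. \<U> n \<in> open_covers Z) \<longrightarrow>
      (\<exists>\<F> :: nat \<Rightarrow> 'a set set.
        (\<forall>n. \<F> n \<in> nonempty_finite_subsets (\<U> n)) \<and>
        (\<forall>z \<in> topspace Z. \<exists>m. \<forall>n\<ge>m. z \<in> \<Union>(\<F> n))))"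

definition S_fin :: "'a set set \<Rightarrow> 'a set set \<Rightarrow> bool" where
  "S_fin \<A> \<B> \<longleftrightarrow>
    (\<forall>\<U> :: nat \<Rightarrow> 'a set. (\<forall>n. \<U> n \<in> \<A>) \<longrightarrow>
      (\<exists>\<F> :: nat \<Rightarrow> 'a set.
        (\<forall>n. \<F> n \<in> nonempty_finite_subsets (\<U> n)) \<and> (\<Union>n. \<F> n) \<in> \<B>))"

text \<open>Histories are lists of moves open to Two; the values of \<open>\<sigma>\<close> on other lists are
  irrelevant.\<close>

definition strategy_One :: "'a set set \<Rightarrow> ('a set list \<Rightarrow> 'a set) \<Rightarrow> bool" where
  "strategy_One \<A> \<sigma> \<longleftrightarrow>
    (\<forall>s \<in> lists (\<Union>A\<in>\<A>. nonempty_finite_subsets A). \<sigma> s \<in> \<A>)"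

definition winning_strategy_One_G_fin ::
    "'a set set \<Rightarrow> 'a set set \<Rightarrow> ('a set list \<Rightarrow> 'a set) \<Rightarrow> bool" where
  "winning_strategy_One_G_fin \<A> \<B> \<sigma> \<longleftrightarrow>
    strategy_One \<A> \<sigma> \<and>
    (\<forall>\<F> :: nat \<Rightarrow> 'a set.
      (\<forall>n. \<F> n \<in> nonempty_finite_subsets (\<sigma> (map \<F> [0..<n]))) \<longrightarrow> (\<Union>n. \<F> n) \<notin> \<B>)"

definition Vietoris :: "'a topology \<Rightarrow> 'a set topology" where
  "Vietoris X = topology_generated_by
    ({{K. compactin X K \<and> K \<noteq> {} \<and> K \<subseteq> U} | U. openin X U} \<union>
     {{K. compactin X K \<and> K \<noteq> {} \<and> K \<inter> U \<noteq> {}} | U. openin X U})"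

definition P_fin :: "'a topology \<Rightarrow> 'a set topology" where
  "P_fin X = subtopology (Vietoris X) (nonempty_finite_subsets (topspace X))"

lemma topspace_Vietoris: "topspace (Vietoris X) = {K. compactin X K \<and> K \<noteq> {}}"
proof -
  have "K \<subseteq> topspace X" if "compactin X K" for K
    using that by (rule compactin_subset_topspace)
  then show ?thesis
    unfolding Vietoris_def topology_generated_by_topspace by blast
qed

lemma topspace_P_fin: "topspace (P_fin X) = nonempty_finite_subsets (topspace X)"
  by (auto simp: P_fin_def topspace_Vietoris nonempty_finite_subsets_def
      intro: finite_imp_compactin)

end

theory Submission
  imports Defs
begin

text \<open>All five conditions are compared with one intermediate property, the omega-Hurewicz
  property: from any sequence of omega-covers one can select finite parts so that every finite set
  is contained in a member of almost every selected part.

  For the selection principle and the game, the essential step is to defeat a given strategy of One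
  with the omega-Hurewicz property (\<open>no_winning_strategy_if_omega_Hurewicz\<close>). One's answers
  can be thinned out to countable omega-covers, and then only countably many positions are relevant;
  the property is applied to all positions simultaneously. Since an omega-cover stays an omega-cover
  after the removal of finitely many members, Two can play pairwise disjoint moves, which makes
  the result groupable. Conversely, late groups of a groupable selection from refining covers form
  the selection sought (\<open>omega_Hurewicz_if_S_fin\<close>).

  For the spaces built from \<open>X\<close>, the finite subsets of an open set \<open>U\<close> form an open set of the
  hyperspace, and the tuples with entries in \<open>U\<close> an open set of the power; in this way omega-covers
  of \<open>X\<close> become covers, and the Hurewicz property of the hyperspace or of all finite powers gives
  the omega-Hurewicz property of \<open>X\<close>. In the other direction, compactness of finite sets yields for
  each finite \<open>A\<close> an open \<open>V\<close> around \<open>A\<close> such that finitely many members of a given cover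
  cover all finite subsets of \<open>V\<close>, or all tuples with entries in \<open>V\<close>
  (\<open>P_fin_tube\<close>, \<open>power_tube\<close>). Such \<open>V\<close> form an omega-cover of \<open>X\<close>
  (\<open>omega_Hurewicz_select_witnesses\<close>).\<close>

section \<open>Covers that capture finite sets\<close>

definition omega_Hurewicz :: "'a topology \<Rightarrow> bool" where
  "omega_Hurewicz Z \<longleftrightarrow>
    (\<forall>\<U> :: nat \<Rightarrow> 'a set set. (\<forall>n. \<U> n \<in> omega_covers Z) \<longrightarrow>
      (\<exists>\<F> :: nat \<Rightarrow> 'a set set.
        (\<forall>n. \<F> n \<in> nonempty_finite_subsets (\<U> n)) \<and>
        (\<forall>A \<in> nonempty_finite_subsets (topspace Z). \<exists>m. \<forall>n\<ge>m. \<exists>U\<in>\<F> n. A \<subseteq> U)))"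

lemma omega_coversI:
  assumes "\<U> \<subseteq> nontrivial_opens Z"
    and "\<And>A. A \<in> nonempty_finite_subsets (topspace Z) \<Longrightarrow> \<exists>U\<in>\<U>. A \<subseteq> U"
  shows "\<U> \<in> omega_covers Z"
proof -
  have "z \<in> \<Union>\<U>" if "z \<in> topspace Z" for z
    using assms(2)[of "{z}"] that by (auto simp: nonempty_finite_subsets_def)
  moreover have "\<Union>\<U> \<subseteq> topspace Z"
    using assms(1) openin_subset by (intro Sup_least) (auto simp: nontrivial_opens_def)
  ultimately have "\<Union>\<U> = topspace Z"
    by (intro equalityI subsetI) auto
  then show ?thesis
    using assms by (simp add: omega_covers_def open_covers_def)
qed

lemma omega_Hurewicz_select:
  fixes \<U> :: "nat \<Rightarrow> 'a set set"
  assumes "omega_Hurewicz Z" "\<And>n. \<U> n \<in> omega_covers Z"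
  obtains \<F> where "\<And>n. \<F> n \<in> nonempty_finite_subsets (\<U> n)"
    and "\<And>A. A \<in> nonempty_finite_subsets (topspace Z) \<Longrightarrow> \<exists>m. \<forall>n\<ge>m. \<exists>U\<in>\<F> n. A \<subseteq> U"
  using assms unfolding omega_Hurewicz_def by metis

lemma omega_covers_nontrivial: "\<U> \<in> omega_covers Z \<Longrightarrow> U \<in> \<U> \<Longrightarrow> U \<in> nontrivial_opens Z"
  by (auto simp: omega_covers_def open_covers_def)

lemma omega_covers_capture:
  assumes "\<U> \<in> omega_covers Z" "A \<in> nonempty_finite_subsets (topspace Z)"
  obtains U where "U \<in> \<U>" "A \<subseteq> U"
  using assms by (auto simp: omega_covers_def)

lemma nonempty_finite_subsetsI:
  "F \<subseteq> Y \<Longrightarrow> finite F \<Longrightarrow> F \<noteq> {} \<Longrightarrow> F \<in> nonempty_finite_subsets Y"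
  by (simp add: nonempty_finite_subsets_def)

lemma nonempty_finite_subsetsD:
  assumes "F \<in> nonempty_finite_subsets Y"
  shows "F \<subseteq> Y" "finite F" "F \<noteq> {}"
  using assms by (auto simp: nonempty_finite_subsets_def)

text \<open>A finite set can be enlarged by one point outside each of the removed members; a member
  that captures the larger set has survived the removal.\<close>

lemma omega_covers_Diff_finite:
  assumes \<U>: "\<U> \<in> omega_covers Z" and "finite \<P>"
  shows "\<U> - \<P> \<in> omega_covers Z"
proof (rule omega_coversI)
  show "\<U> - \<P> \<subseteq> nontrivial_opens Z"
    using omega_covers_nontrivial[OF \<U>] by blast
  fix A assume A: "A \<in> nonempty_finite_subsets (topspace Z)"
  have "\<exists>p. p \<in> topspace Z - U" if "U \<in> \<U>" for U
    using omega_covers_nontrivial[OF \<U> that] openin_subset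
    by (fastforce simp: nontrivial_opens_def)
  then obtain p where p: "\<And>U. U \<in> \<U> \<Longrightarrow> p U \<in> topspace Z - U"
    by metis
  have "A \<union> p ` (\<U> \<inter> \<P>) \<in> nonempty_finite_subsets (topspace Z)"
    using A p \<open>finite \<P>\<close> by (auto simp: nonempty_finite_subsets_def)
  then obtain U where "U \<in> \<U>" "A \<union> p ` (\<U> \<inter> \<P>) \<subseteq> U"
    by (rule omega_covers_capture[OF \<U>])
  then show "\<exists>U\<in>\<U> - \<P>. A \<subseteq> U"
    using p by blast
qed

section \<open>Groupable selections and the game\<close>

text \<open>The selection principle is applied to covers \<open>W n\<close> whose members refine all given covers up to
  index \<open>n\<close>. Only finitely many groups meet the finitely many sets chosen before step \<open>n\<close>, so
  all late groups refine the cover of index \<open>n\<close>. Any infinite union of groups is an omega-cover,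
  hence a given finite set is captured by almost every group.\<close>

lemma omega_Hurewicz_if_S_fin:
  assumes S: "S_fin (omega_covers Z) (groupable (omega_covers Z))"
  shows "omega_Hurewicz Z"
  unfolding omega_Hurewicz_def
proof (intro allI impI)
  fix \<U> :: "nat \<Rightarrow> 'a set set"
  assume \<U>: "\<forall>n. \<U> n \<in> omega_covers Z"
  define W where "W n = {V \<in> nontrivial_opens Z. \<forall>i\<le>n. \<exists>U\<in>\<U> i. V \<subseteq> U}" for n
  have "W n \<in> omega_covers Z" for n
  proof (rule omega_coversI)
    show "W n \<subseteq> nontrivial_opens Z" by (auto simp: W_def)
    fix A assume A: "A \<in> nonempty_finite_subsets (topspace Z)"
    have "\<forall>i. \<exists>U. U \<in> \<U> i \<and> A \<subseteq> U"
      using \<U> A omega_covers_capture by metis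
    then obtain u where u: "\<And>i. u i \<in> \<U> i" "\<And>i. A \<subseteq> u i" by metis
    have uo: "u i \<in> nontrivial_opens Z" for i
      using omega_covers_nontrivial \<U> u by blast
    have "openin Z (\<Inter>i\<in>{..n}. u i)"
      by (rule openin_INT2) (use uo in \<open>auto simp: nontrivial_opens_def\<close>)
    moreover have "(\<Inter>i\<in>{..n}. u i) \<noteq> topspace Z"
      using uo[of 0] openin_subset[of Z "u 0"] by (fastforce simp: nontrivial_opens_def)
    moreover have "A \<subseteq> (\<Inter>i\<in>{..n}. u i)" "A \<noteq> {}"
      using u A by (auto simp: nonempty_finite_subsets_def)
    ultimately have "(\<Inter>i\<in>{..n}. u i) \<in> W n"
      unfolding W_def nontrivial_opens_def using u by blast
    then show "\<exists>U\<in>W n. A \<subseteq> U"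
      using \<open>A \<subseteq> (\<Inter>i\<in>{..n}. u i)\<close> by blast
  qed
  then obtain F where F: "\<And>n. F n \<in> nonempty_finite_subsets (W n)"
    and gp: "(\<Union>n. F n) \<in> groupable (omega_covers Z)"
    using S unfolding S_fin_def by metis
  from gp obtain \<phi> :: "'a set \<Rightarrow> nat"
    where fin: "\<And>m. finite {C \<in> (\<Union>n. F n). \<phi> C = m}"
      and inf: "\<And>J. infinite J \<Longrightarrow> (\<Union>m\<in>J. {C \<in> (\<Union>n. F n). \<phi> C = m}) \<in> omega_covers Z"
    unfolding groupable_def by blast
  define g where "g m = {C \<in> (\<Union>n. F n). \<phi> C = m}" for m
  have late: "\<exists>M. \<forall>m\<ge>M. \<forall>C\<in>g m. \<exists>U\<in>\<U> n. C \<subseteq> U" for n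
  proof -
    have "finite (\<phi> ` (\<Union>k<n. F k))"
      using F by (auto simp: nonempty_finite_subsets_def)
    then obtain M where "\<forall>i \<in> \<phi> ` (\<Union>k<n. F k). i < M"
      unfolding finite_nat_set_iff_bounded ..
    then have M: "\<phi> C < M" if "C \<in> F k" "k < n" for C k
      using that by auto
    have "\<exists>U\<in>\<U> n. C \<subseteq> U" if m: "m \<ge> M" and C: "C \<in> g m" for m C
    proof -
      obtain k where k: "C \<in> F k" using C by (auto simp: g_def)
      moreover have "\<phi> C = m" using C by (simp add: g_def)
      ultimately have "k \<ge> n" using M[of C k] m by (meson leD not_le_imp_less)
      have "C \<in> W k" using k nonempty_finite_subsetsD(1)[OF F] by blast
      then show ?thesis using \<open>k \<ge> n\<close> by (auto simp: W_def)
    qed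
    then show ?thesis by blast
  qed
  then obtain M where M: "\<And>n m C. m \<ge> M n \<Longrightarrow> C \<in> g m \<Longrightarrow> \<exists>U\<in>\<U> n. C \<subseteq> U"
    by metis
  \<comment> \<open>adding \<open>n\<close> makes the chosen groups tend to infinity\<close>
  define h where "h n = M n + n" for n
  have "\<exists>G. G \<in> nonempty_finite_subsets (\<U> n) \<and> (\<forall>C\<in>g (h n). \<exists>U\<in>G. C \<subseteq> U)" for n
  proof -
    have "\<forall>C\<in>g (h n). \<exists>U. U \<in> \<U> n \<and> C \<subseteq> U"
      using M[of n "h n"] by (auto simp: h_def)
    then obtain u where u: "\<And>C. C \<in> g (h n) \<Longrightarrow> u C \<in> \<U> n \<and> C \<subseteq> u C"
      by metis
    \<comment> \<open>a group may be empty, whereas a selection may not\<close>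
    have "W n \<noteq> {}" using F[of n] by (auto simp: nonempty_finite_subsets_def)
    then obtain U0 where "U0 \<in> \<U> n" unfolding W_def by blast
    then have "insert U0 (u ` g (h n)) \<in> nonempty_finite_subsets (\<U> n)"
      using u fin[of "h n"] by (auto simp: nonempty_finite_subsets_def g_def)
    then show ?thesis using u by blast
  qed
  then obtain G where G: "\<And>n. G n \<in> nonempty_finite_subsets (\<U> n)"
    and ref: "\<And>n C. C \<in> g (h n) \<Longrightarrow> \<exists>U\<in>G n. C \<subseteq> U"
    by metis
  have "\<exists>m. \<forall>n\<ge>m. \<exists>U\<in>G n. A \<subseteq> U" if A: "A \<in> nonempty_finite_subsets (topspace Z)" for A
  proof -
    define J where "J = {m. \<not> (\<exists>C\<in>g m. A \<subseteq> C)}"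
    have "finite J"
    proof (rule ccontr)
      assume "infinite J"
      from omega_covers_capture[OF inf[OF this, folded g_def] A]
      obtain C where "C \<in> (\<Union>m\<in>J. g m)" "A \<subseteq> C" .
      then show False unfolding J_def by blast
    qed
    then obtain k where k: "\<forall>m\<in>J. m < k"
      unfolding finite_nat_set_iff_bounded ..
    have "\<exists>U\<in>G n. A \<subseteq> U" if "n \<ge> k" for n
    proof -
      have "h n \<notin> J" using k that by (fastforce simp: h_def)
      then obtain C where "C \<in> g (h n)" "A \<subseteq> C" unfolding J_def by blast
      then show ?thesis using ref by (meson order_trans)
    qed
    then show ?thesis by blast
  qed
  then show "\<exists>\<F>. (\<forall>n. \<F> n \<in> nonempty_finite_subsets (\<U> n)) \<and>
      (\<forall>A\<in>nonempty_finite_subsets (topspace Z). \<exists>m. \<forall>n\<ge>m. \<exists>U\<in>\<F> n. A \<subseteq> U)"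
    using G by blast
qed

lemma omega_Hurewicz_countable_subcover:
  assumes H: "omega_Hurewicz Z" and \<U>: "\<U> \<in> omega_covers Z"
  obtains c :: "nat \<Rightarrow> 'a set" where "range c \<subseteq> \<U>" "range c \<in> omega_covers Z"
proof -
  obtain F where F: "\<And>n::nat. F n \<in> nonempty_finite_subsets \<U>"
    and cap: "\<And>A. A \<in> nonempty_finite_subsets (topspace Z) \<Longrightarrow>
        \<exists>m. \<forall>n\<ge>m. \<exists>U\<in>F n. A \<subseteq> U"
    using omega_Hurewicz_select[OF H, of "\<lambda>_. \<U>"] \<U> by metis
  have "countable (\<Union>n. F n)" "(\<Union>n. F n) \<noteq> {}"
    using F by (auto simp: nonempty_finite_subsets_def intro: countable_finite)
  then have r: "range (from_nat_into (\<Union>n. F n)) = (\<Union>n. F n)"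
    by (simp add: range_from_nat_into)
  have sub: "(\<Union>n. F n) \<subseteq> \<U>"
    using F by (auto simp: nonempty_finite_subsets_def)
  have "(\<Union>n. F n) \<in> omega_covers Z"
  proof (rule omega_coversI)
    show "(\<Union>n. F n) \<subseteq> nontrivial_opens Z"
      using sub omega_covers_nontrivial[OF \<U>] by blast
  next
    fix A assume "A \<in> nonempty_finite_subsets (topspace Z)"
    then obtain m where "\<forall>n\<ge>m. \<exists>U\<in>F n. A \<subseteq> U" using cap by metis
    then have "\<exists>U\<in>F m. A \<subseteq> U" by simp
    then show "\<exists>U\<in>(\<Union>n. F n). A \<subseteq> U" by auto
  qed
  then show thesis
    using that[of "from_nat_into (\<Union>n. F n)"] r sub by simp
qed

text \<open>After replacing each answer of One by a countable omega-subcover that avoids what Two has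
  already taken, and restricting Two to finite initial segments of its enumeration, only countably
  many positions remain. One application of the omega-Hurewicz property to all of them at once
  yields a reply at every position such that a given finite set is captured at all but finitely many
  positions, in particular at all but finitely many positions along the play in which Two follows
  these replies. The moves of that play are pairwise disjoint, so they group their union.\<close>

lemma no_winning_strategy_if_omega_Hurewicz:
  assumes H: "omega_Hurewicz Z"
  shows "\<not> winning_strategy_One_G_fin (omega_covers Z) (groupable (omega_covers Z)) \<sigma>"
proof
  assume win: "winning_strategy_One_G_fin (omega_covers Z) (groupable (omega_covers Z)) \<sigma>"
  define L where "L = lists (\<Union>A\<in>omega_covers Z. nonempty_finite_subsets A)"
  have \<sigma>: "\<sigma> s \<in> omega_covers Z" if "s \<in> L" for s
    using win that unfolding winning_strategy_One_G_fin_def strategy_One_def L_def by blast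
  have lose: "(\<Union>n. F n) \<notin> groupable (omega_covers Z)"
    if "\<And>n. F n \<in> nonempty_finite_subsets (\<sigma> (map F [0..<n]))" for F :: "nat \<Rightarrow> 'a set set"
    using win that unfolding winning_strategy_One_G_fin_def by blast
  have "\<exists>c :: nat \<Rightarrow> 'a set. range c \<subseteq> \<sigma> s - \<Union>(set s) \<and> range c \<in> omega_covers Z"
    if "s \<in> L" for s
  proof -
    have "finite (\<Union>(set s))"
      using that unfolding L_def by (auto simp: nonempty_finite_subsets_def lists_eq_set)
    from omega_covers_Diff_finite[OF \<sigma>[OF that] this] show ?thesis
      using omega_Hurewicz_countable_subcover[OF H] by metis
  qed
  then obtain c :: "'a set set list \<Rightarrow> nat \<Rightarrow> 'a set"
    where c: "\<And>s. s \<in> L \<Longrightarrow> range (c s) \<subseteq> \<sigma> s - \<Union>(set s)"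
      and c\<Omega>: "\<And>s. s \<in> L \<Longrightarrow> range (c s) \<in> omega_covers Z"
    by metis
  \<comment> \<open>the position reached when Two plays the initial segments whose last indices are
      listed, most recent first\<close>
  define pos where "pos = rec_list [] (\<lambda>k _ s. s @ [c s ` {..k}])"
  have pos_simps: "pos [] = []" "pos (k # t) = pos t @ [c (pos t) ` {..k}]" for k t
    by (simp_all add: pos_def)
  have posL: "pos t \<in> L" for t
  proof (induction t)
    case Nil
    then show ?case by (simp add: pos_simps L_def)
  next
    case (Cons k t)
    have "c (pos t) ` {..k} \<in> nonempty_finite_subsets (\<sigma> (pos t))"
      using c[OF Cons] by (auto simp: nonempty_finite_subsets_def)
    then show ?case
      using Cons \<sigma>[OF Cons] by (auto simp: pos_simps L_def)
  qed
  obtain E where E: "\<And>i::nat. E i \<in> nonempty_finite_subsets (range (c (pos (from_nat i))))"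
    and cap: "\<And>A. A \<in> nonempty_finite_subsets (topspace Z) \<Longrightarrow>
        \<exists>m. \<forall>i\<ge>m. \<exists>U\<in>E i. A \<subseteq> U"
    using omega_Hurewicz_select[OF H, of "\<lambda>i. range (c (pos (from_nat i)))"] c\<Omega>[OF posL]
    by metis
  have "\<exists>k. E (to_nat t) \<subseteq> c (pos t) ` {..k}" for t :: "nat list"
  proof -
    have "E (to_nat t) \<subseteq> c (pos t) ` UNIV" "finite (E (to_nat t))"
      using E[of "to_nat t"] by (auto simp: nonempty_finite_subsets_def)
    then obtain I where "finite I" "E (to_nat t) = c (pos t) ` I"
      by (meson finite_subset_image)
    moreover obtain k where "I \<subseteq> {..k}"
      using \<open>finite I\<close> finite_nat_iff_bounded_le by blast
    ultimately show ?thesis by (metis image_mono)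
  qed
  then obtain r where r: "\<And>t :: nat list. E (to_nat t) \<subseteq> c (pos t) ` {..r t}"
    by metis
  define b where "b = rec_nat [] (\<lambda>_ t. r t # t)"
  have b_simps: "b 0 = []" "b (Suc n) = r (b n) # b n" for n
    by (simp_all add: b_def)
  define F where "F n = c (pos (b n)) ` {..r (b n)}" for n
  have pos_b: "pos (b n) = map F [0..<n]" for n
    by (induction n) (simp_all add: b_simps pos_simps F_def)
  have F: "F n \<in> nonempty_finite_subsets (\<sigma> (map F [0..<n]) - (\<Union>k<n. F k))" for n
  proof -
    have "range (c (pos (b n))) \<subseteq> \<sigma> (map F [0..<n]) - (\<Union>k<n. F k)"
      using c[OF posL[of "b n"]] by (simp add: pos_b atLeast0LessThan)
    then show ?thesis
      by (auto simp: F_def nonempty_finite_subsets_def)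
  qed
  have capF: "\<exists>m. \<forall>n\<ge>m. \<exists>U\<in>F n. A \<subseteq> U"
    if A: "A \<in> nonempty_finite_subsets (topspace Z)" for A
  proof -
    obtain m where m: "\<And>i. i \<ge> m \<Longrightarrow> \<exists>U\<in>E i. A \<subseteq> U" using cap[OF A] by blast
    \<comment> \<open>the play never returns to a position, so it meets only finitely many of the exceptions\<close>
    have "length (b n) = n" for n
      by (induction n) (simp_all add: b_simps)
    then have "inj (\<lambda>n. to_nat (b n))"
      by (metis injI to_nat_split)
    then have "finite ((\<lambda>n. to_nat (b n)) -` {..<m})"
      by (intro finite_vimageI) auto
    then obtain N where N: "\<And>n. to_nat (b n) < m \<Longrightarrow> n < N"
      using finite_nat_set_iff_bounded by (metis lessThan_iff vimageI2 vimage_eq)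
    have "\<exists>U\<in>F n. A \<subseteq> U" if "n \<ge> N" for n
      using m[of "to_nat (b n)"] N[of n] that r[of "b n"] unfolding F_def
      by (meson leD not_le_imp_less subsetD)
    then show ?thesis by blast
  qed
  have disj: "k = n" if "C \<in> F k" "C \<in> F n" for C k n
  proof (rule ccontr)
    assume "k \<noteq> n"
    then show False
      using that F[of k] F[of n] unfolding nonempty_finite_subsets_def
      by (cases k n rule: linorder_cases) blast+
  qed
  have group: "{C \<in> (\<Union>n. F n). (THE n. C \<in> F n) = m} = F m" for m
  proof -
    have "(THE n. C \<in> F n) = k" if "C \<in> F k" for C k
      using that disj by blast
    then show ?thesis by auto
  qed
  have F\<Omega>: "(\<Union>n\<in>J. F n) \<in> omega_covers Z" if J: "infinite J" for J
  proof (rule omega_coversI)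
    have "F n \<subseteq> nontrivial_opens Z" for n
      using F[of n] omega_covers_nontrivial[OF \<sigma>[OF posL[of "b n"]]]
      by (auto simp: pos_b nonempty_finite_subsets_def)
    then show "(\<Union>n\<in>J. F n) \<subseteq> nontrivial_opens Z" by blast
    fix A assume "A \<in> nonempty_finite_subsets (topspace Z)"
    then obtain m where "\<And>n. n \<ge> m \<Longrightarrow> \<exists>U\<in>F n. A \<subseteq> U"
      using capF by blast
    moreover obtain n where "n \<in> J" "n \<ge> m"
      using J unfolding infinite_nat_iff_unbounded_le by blast
    ultimately have "n \<in> J" "\<exists>U\<in>F n. A \<subseteq> U" by simp_all
    then show "\<exists>U\<in>(\<Union>n\<in>J. F n). A \<subseteq> U" by (meson UN_I)
  qed
  have "(\<Union>n. F n) \<in> groupable (omega_covers Z)"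
    unfolding groupable_def
  proof (intro CollectI conjI exI[of _ "\<lambda>C. THE n. C \<in> F n"] allI impI)
    show "(\<Union>n. F n) \<in> omega_covers Z"
      using F\<Omega>[of UNIV] by simp
  next
    fix m show "finite {C \<in> (\<Union>n. F n). (THE n. C \<in> F n) = m}"
      unfolding group by (simp add: F_def)
  next
    fix J :: "nat set" assume "infinite J"
    then show "(\<Union>m\<in>J. {C \<in> (\<Union>n. F n). (THE n. C \<in> F n) = m}) \<in> omega_covers Z"
      unfolding group by (rule F\<Omega>)
  qed
  moreover have "F n \<in> nonempty_finite_subsets (\<sigma> (map F [0..<n]))" for n
    using F[of n] by (auto simp: nonempty_finite_subsets_def)
  ultimately show False
    using lose by blast
qed

text \<open>A sequence of covers is a strategy that looks only at the number of the inning.\<close>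

lemma S_fin_if_no_winning_strategy:
  assumes "\<nexists>\<sigma>. winning_strategy_One_G_fin \<A> \<B> \<sigma>"
  shows "S_fin \<A> \<B>"
  unfolding S_fin_def
proof (intro allI impI)
  fix \<U> :: "nat \<Rightarrow> 'a set" assume \<U>: "\<forall>n. \<U> n \<in> \<A>"
  have "\<not> winning_strategy_One_G_fin \<A> \<B> (\<lambda>s. \<U> (length s))"
    using assms by blast
  then show "\<exists>\<F>. (\<forall>n. \<F> n \<in> nonempty_finite_subsets (\<U> n)) \<and> (\<Union>n. \<F> n) \<in> \<B>"
    using \<U> unfolding winning_strategy_One_G_fin_def strategy_One_def by auto
qed

lemma S_fin_iff_omega_Hurewicz:
  "S_fin (omega_covers Z) (groupable (omega_covers Z)) \<longleftrightarrow> omega_Hurewicz Z"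
  using omega_Hurewicz_if_S_fin S_fin_if_no_winning_strategy no_winning_strategy_if_omega_Hurewicz
  by blast

lemma no_winning_strategy_iff_omega_Hurewicz:
  "\<not> (\<exists>\<sigma>. winning_strategy_One_G_fin (omega_covers Z) (groupable (omega_covers Z)) \<sigma>) \<longleftrightarrow>
    omega_Hurewicz Z"
  using omega_Hurewicz_if_S_fin S_fin_if_no_winning_strategy no_winning_strategy_if_omega_Hurewicz
  by blast

section \<open>Transfer between the base space and its hyperspace and powers\<close>

text \<open>\<open>Q V \<G>\<close> stands for a smallness property of \<open>V\<close> witnessed by \<open>\<G>\<close>, such as:
  everything built from points of \<open>V\<close> is covered by \<open>\<G>\<close>. The sets that are small with respect to
  the \<open>n\<close>-th family form an omega-cover. Selecting from these covers and
  collecting the witnesses gives a selection from the families. In an infinite T1 space a finite set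
  misses some closed point, whose removal keeps a captured set different from the whole space.\<close>

lemma omega_Hurewicz_select_witnesses:
  fixes \<U> :: "nat \<Rightarrow> 'b set"
  assumes H: "omega_Hurewicz X" and "t1_space X" and "infinite (topspace X)"
    and small: "\<And>n A. A \<in> nonempty_finite_subsets (topspace X) \<Longrightarrow>
      \<exists>V \<G>. openin X V \<and> A \<subseteq> V \<and> \<G> \<in> nonempty_finite_subsets (\<U> n) \<and> Q V \<G>"
    and anti: "\<And>V V' \<G>. Q V \<G> \<Longrightarrow> V' \<subseteq> V \<Longrightarrow> Q V' \<G>"
  shows "\<exists>\<F>. (\<forall>n. \<F> n \<in> nonempty_finite_subsets (\<U> n)) \<and>
    (\<forall>A \<in> nonempty_finite_subsets (topspace X).
      \<exists>m. \<forall>n\<ge>m. \<exists>V \<G>. A \<subseteq> V \<and> \<G> \<subseteq> \<F> n \<and> Q V \<G>)"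
proof -
  define \<V> where "\<V> n =
    {V \<in> nontrivial_opens X. \<exists>\<G> \<in> nonempty_finite_subsets (\<U> n). Q V \<G>}" for n
  have "\<V> n \<in> omega_covers X" for n
  proof (rule omega_coversI)
    show "\<V> n \<subseteq> nontrivial_opens X" by (auto simp: \<V>_def)
    fix A assume A: "A \<in> nonempty_finite_subsets (topspace X)"
    then obtain V \<G> where V: "openin X V" "A \<subseteq> V" "\<G> \<in> nonempty_finite_subsets (\<U> n)" "Q V \<G>"
      using small by blast
    have "topspace X - A \<noteq> {}"
      using A assms(3) by (metis Diff_eq_empty_iff finite_subset nonempty_finite_subsetsD(2))
    then obtain p where p: "p \<in> topspace X" "p \<notin> A" by blast
    have "openin X (V - {p})"
      using V(1) p(1) \<open>t1_space X\<close> by (simp add: openin_diff closedin_t1_singleton)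
    then have "V - {p} \<in> nontrivial_opens X"
      using A V(2) p by (auto simp: nontrivial_opens_def nonempty_finite_subsets_def)
    moreover have "Q (V - {p}) \<G>" using anti[OF V(4)] by blast
    ultimately have "V - {p} \<in> \<V> n" using V(3) by (auto simp: \<V>_def)
    then show "\<exists>V\<in>\<V> n. A \<subseteq> V"
      by (rule bexI[rotated]) (use V(2) p(2) in auto)
  qed
  then obtain F where F: "\<And>n. F n \<in> nonempty_finite_subsets (\<V> n)"
    and cap: "\<And>A. A \<in> nonempty_finite_subsets (topspace X) \<Longrightarrow>
        \<exists>m. \<forall>n\<ge>m. \<exists>V\<in>F n. A \<subseteq> V"
    using omega_Hurewicz_select[OF H, of \<V>] by metis
  have "\<forall>n V. \<exists>\<G>. V \<in> \<V> n \<longrightarrow> \<G> \<in> nonempty_finite_subsets (\<U> n) \<and> Q V \<G>"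
    by (auto simp: \<V>_def)
  then obtain w where w: "\<And>n V. V \<in> \<V> n \<Longrightarrow> w n V \<in> nonempty_finite_subsets (\<U> n)"
      "\<And>n V. V \<in> \<V> n \<Longrightarrow> Q V (w n V)"
    by metis
  show ?thesis
  proof (intro exI[of _ "\<lambda>n. \<Union>V\<in>F n. w n V"] conjI allI ballI)
    fix n
    show "(\<Union>V\<in>F n. w n V) \<in> nonempty_finite_subsets (\<U> n)"
    proof (rule nonempty_finite_subsetsI)
      have sub: "F n \<subseteq> \<V> n" and fin: "finite (F n)" and ne: "F n \<noteq> {}"
        using nonempty_finite_subsetsD[OF F] by auto
      show "(\<Union>V\<in>F n. w n V) \<subseteq> \<U> n"
        using sub nonempty_finite_subsetsD(1)[OF w(1)] by blast
      show "finite (\<Union>V\<in>F n. w n V)"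
        using fin sub nonempty_finite_subsetsD(2)[OF w(1)] by blast
      show "(\<Union>V\<in>F n. w n V) \<noteq> {}"
        using ne sub nonempty_finite_subsetsD(3)[OF w(1)] by blast
    qed
  next
    fix A assume "A \<in> nonempty_finite_subsets (topspace X)"
    then obtain m where m: "\<And>n. n \<ge> m \<Longrightarrow> \<exists>V\<in>F n. A \<subseteq> V"
      using cap by blast
    have "\<exists>V \<G>. A \<subseteq> V \<and> \<G> \<subseteq> (\<Union>V\<in>F n. w n V) \<and> Q V \<G>" if n: "n \<ge> m" for n
    proof -
      obtain V where V: "V \<in> F n" "A \<subseteq> V" using m[OF n] by blast
      then have "V \<in> \<V> n" using nonempty_finite_subsetsD(1)[OF F] by blast
      then show ?thesis using V w(2) by blast
    qed
    then show "\<exists>m. \<forall>n\<ge>m. \<exists>V \<G>. A \<subseteq> V \<and> \<G> \<subseteq> (\<Union>V\<in>F n. w n V) \<and> Q V \<G>"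
      by blast
  qed
qed

text \<open>The converse direction, for \<open>e U\<close> the set of finite subsets of \<open>U\<close>, or of tuples with entries
  in \<open>U\<close>: the points of \<open>Z\<close> then encode the finite sets that are to be captured.\<close>

lemma Hurewicz_select_through:
  fixes \<U> :: "nat \<Rightarrow> 'a set set" and e :: "'a set \<Rightarrow> 'b set"
  assumes H: "Hurewicz Z"
    and nontriv: "\<And>n U. U \<in> \<U> n \<Longrightarrow> e U \<in> nontrivial_opens Z"
    and cover: "\<And>n z. z \<in> topspace Z \<Longrightarrow> \<exists>U\<in>\<U> n. z \<in> e U"
  shows "\<exists>\<F>. (\<forall>n. \<F> n \<in> nonempty_finite_subsets (\<U> n)) \<and>
    (\<forall>z \<in> topspace Z. \<exists>m. \<forall>n\<ge>m. \<exists>U\<in>\<F> n. z \<in> e U)"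
proof -
  have "e ` \<U> n \<in> open_covers Z" for n
  proof -
    have "e U \<subseteq> topspace Z" if "U \<in> \<U> n" for U
      using nontriv[OF that] openin_subset by (auto simp: nontrivial_opens_def)
    then show ?thesis
      using nontriv cover[of _ n] unfolding open_covers_def by blast
  qed
  then obtain E where E: "\<And>n. E n \<in> nonempty_finite_subsets (e ` \<U> n)"
    and cap: "\<And>z. z \<in> topspace Z \<Longrightarrow> \<exists>m. \<forall>n\<ge>m. z \<in> \<Union>(E n)"
    using H[unfolded Hurewicz_def, rule_format, of "\<lambda>n. e ` \<U> n"] by blast
  have "\<exists>F. F \<in> nonempty_finite_subsets (\<U> n) \<and> E n = e ` F" for n
    using nonempty_finite_subsetsD[OF E[of n]]
    by (metis finite_subset_image image_empty nonempty_finite_subsetsI)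
  then obtain F where F: "\<And>n. F n \<in> nonempty_finite_subsets (\<U> n)" "\<And>n. E n = e ` F n"
    by metis
  then show ?thesis
    using cap by (intro exI[of _ F]) simp
qed

section \<open>The hyperspace of finite sets\<close>

definition box_P_fin :: "'a topology \<Rightarrow> 'a set \<Rightarrow> 'a set set" where
  "box_P_fin X U = {K \<in> nonempty_finite_subsets (topspace X). K \<subseteq> U}"

lemma box_P_fin_mono: "U \<subseteq> V \<Longrightarrow> box_P_fin X U \<subseteq> box_P_fin X V"
  by (auto simp: box_P_fin_def)

lemma openin_box_P_fin:
  assumes "openin X U" shows "openin (P_fin X) (box_P_fin X U)"
proof -
  have "openin (Vietoris X) {K. compactin X K \<and> K \<noteq> {} \<and> K \<subseteq> U}"
    unfolding Vietoris_def
    by (rule topology_generated_by_Basis) (use assms in blast)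
  moreover have "box_P_fin X U =
      {K. compactin X K \<and> K \<noteq> {} \<and> K \<subseteq> U} \<inter> nonempty_finite_subsets (topspace X)"
    by (auto simp: box_P_fin_def nonempty_finite_subsets_def intro: finite_imp_compactin)
  ultimately show ?thesis
    unfolding P_fin_def openin_subtopology by blast
qed

lemma box_P_fin_nontrivial:
  assumes "U \<in> nontrivial_opens X"
  shows "box_P_fin X U \<in> nontrivial_opens (P_fin X)"
proof -
  have U: "openin X U" "U \<noteq> {}" "U \<noteq> topspace X" "U \<subseteq> topspace X"
    using assms openin_subset by (auto simp: nontrivial_opens_def)
  obtain x y where "x \<in> U" "y \<in> topspace X" "y \<notin> U"
    using U by blast
  then have "{x} \<in> box_P_fin X U" "{y} \<in> topspace (P_fin X) - box_P_fin X U"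
    using U(4) by (auto simp: box_P_fin_def topspace_P_fin nonempty_finite_subsets_def)
  then show ?thesis
    using openin_box_P_fin[OF U(1)] by (auto simp: nontrivial_opens_def)
qed

text \<open>It suffices to look at the subbasic sets. That \<open>K\<close> meets \<open>U\<close> constrains only the
  neighbourhoods of those points of \<open>G\<close> that lie in \<open>U\<close>; the others may be the whole space.\<close>

lemma P_fin_neighbourhood:
  assumes "openin (P_fin X) W" "G \<in> W"
  shows "\<exists>v. (\<forall>a\<in>G. openin X (v a) \<and> a \<in> v a) \<and>
    (\<forall>K \<in> nonempty_finite_subsets (topspace X).
      K \<subseteq> (\<Union>a\<in>G. v a) \<and> (\<forall>a\<in>G. K \<inter> v a \<noteq> {}) \<longrightarrow> K \<in> W)"
proof -
  let ?Y = "nonempty_finite_subsets (topspace X)"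
  define nbhd where "nbhd S \<longleftrightarrow> (\<exists>v. (\<forall>a\<in>G. openin X (v a) \<and> a \<in> v a) \<and>
    (\<forall>K\<in>?Y. K \<subseteq> (\<Union>a\<in>G. v a) \<and> (\<forall>a\<in>G. K \<inter> v a \<noteq> {}) \<longrightarrow> K \<in> S))" for S
  have nbhd_mono: "nbhd T" if S: "nbhd S" "S \<subseteq> T" for S T
  proof -
    obtain v where v: "\<forall>a\<in>G. openin X (v a) \<and> a \<in> v a"
        "\<forall>K\<in>?Y. K \<subseteq> (\<Union>a\<in>G. v a) \<and> (\<forall>a\<in>G. K \<inter> v a \<noteq> {}) \<longrightarrow> K \<in> S"
      using S(1) unfolding nbhd_def by blast
    then show ?thesis
      using S(2) unfolding nbhd_def by (intro exI[of _ v]) blast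
  qed
  obtain S where S: "openin (Vietoris X) S" "W = S \<inter> ?Y"
    using assms(1) unfolding P_fin_def openin_subtopology by blast
  have G: "G \<in> ?Y" "G \<in> S" using assms(2) S by auto
  have "generate_topology_on
    ({{K. compactin X K \<and> K \<noteq> {} \<and> K \<subseteq> U} | U. openin X U} \<union>
     {{K. compactin X K \<and> K \<noteq> {} \<and> K \<inter> U \<noteq> {}} | U. openin X U}) S"
    using S(1) unfolding Vietoris_def openin_topology_generated_by_iff .
  then have "G \<in> S \<longrightarrow> nbhd S"
  proof (induction rule: generate_topology_on.induct)
    case Empty
    then show ?case by simp
  next
    case (Int S T)
    show ?case
    proof
      assume "G \<in> S \<inter> T"
      then have "nbhd S" "nbhd T" using Int.IH by auto
      from \<open>nbhd S\<close> obtain v where v: "\<forall>a\<in>G. openin X (v a) \<and> a \<in> v a"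
          "\<forall>K\<in>?Y. K \<subseteq> (\<Union>a\<in>G. v a) \<and> (\<forall>a\<in>G. K \<inter> v a \<noteq> {}) \<longrightarrow> K \<in> S"
        unfolding nbhd_def by blast
      from \<open>nbhd T\<close> obtain w where w: "\<forall>a\<in>G. openin X (w a) \<and> a \<in> w a"
          "\<forall>K\<in>?Y. K \<subseteq> (\<Union>a\<in>G. w a) \<and> (\<forall>a\<in>G. K \<inter> w a \<noteq> {}) \<longrightarrow> K \<in> T"
        unfolding nbhd_def by blast
      have "K \<in> S \<inter> T" if K: "K \<in> ?Y" "K \<subseteq> (\<Union>a\<in>G. v a \<inter> w a)"
        "\<forall>a\<in>G. K \<inter> (v a \<inter> w a) \<noteq> {}" for K
      proof -
        have "K \<subseteq> (\<Union>a\<in>G. v a)" "K \<subseteq> (\<Union>a\<in>G. w a)" using K(2) by blast+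
        moreover have "\<forall>a\<in>G. K \<inter> v a \<noteq> {}" "\<forall>a\<in>G. K \<inter> w a \<noteq> {}" using K(3) by blast+
        ultimately show ?thesis using v(2) w(2) K(1) by blast
      qed
      then show "nbhd (S \<inter> T)"
        unfolding nbhd_def using v(1) w(1)
        by (intro exI[of _ "\<lambda>a. v a \<inter> w a"]) (simp add: openin_Int)
    qed
  next
    case (UN \<K>)
    show ?case
    proof
      assume "G \<in> \<Union>\<K>"
      then obtain S where "S \<in> \<K>" "G \<in> S" by blast
      then have "nbhd S" using UN.IH by blast
      then show "nbhd (\<Union>\<K>)" by (rule nbhd_mono) (use \<open>S \<in> \<K>\<close> in blast)
    qed
  next
    case (Basis S)
    then consider U where "openin X U" "S = {K. compactin X K \<and> K \<noteq> {} \<and> K \<subseteq> U}"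
      | U where "openin X U" "S = {K. compactin X K \<and> K \<noteq> {} \<and> K \<inter> U \<noteq> {}}"
      by blast
    then show ?case
    proof cases
      case 1
      then show ?thesis unfolding nbhd_def
        by (intro impI exI[of _ "\<lambda>_. U"])
          (auto simp: nonempty_finite_subsets_def intro: finite_imp_compactin)
    next
      case 2
      show ?thesis
      proof
        assume "G \<in> S"
        then obtain a where "a \<in> G" "a \<in> U" using 2 by blast
        then show "nbhd S" unfolding nbhd_def
          using 2 nonempty_finite_subsetsD[OF G(1)]
          by (intro exI[of _ "\<lambda>a. if a \<in> U then U else topspace X"])
            (auto simp: nonempty_finite_subsets_def intro: finite_imp_compactin)
      qed
    qed
  qed
  then show ?thesis
    using G(2) S(2) unfolding nbhd_def by blast
qed

text \<open>A finite set \<open>K\<close> near \<open>A\<close> need not be Vietoris-close to \<open>A\<close> itself, but it is close to the set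
  of those points of \<open>A\<close> whose neighbourhood it meets. Hence finitely many open sets, one around
  each nonempty subset of \<open>A\<close>, cover all finite subsets of some open \<open>V\<close> around \<open>A\<close>.\<close>

lemma P_fin_tube:
  assumes A: "A \<in> nonempty_finite_subsets (topspace X)"
    and w: "\<And>G. G \<in> nonempty_finite_subsets A \<Longrightarrow> openin (P_fin X) (w G) \<and> G \<in> w G"
  obtains V where "openin X V" "A \<subseteq> V"
    "box_P_fin X V \<subseteq> (\<Union>G\<in>nonempty_finite_subsets A. w G)"
proof -
  let ?Y = "nonempty_finite_subsets (topspace X)"
  have "\<forall>G\<in>nonempty_finite_subsets A. \<exists>v. (\<forall>a\<in>G. openin X (v a) \<and> a \<in> v a) \<and>
    (\<forall>K\<in>?Y. K \<subseteq> (\<Union>a\<in>G. v a) \<and> (\<forall>a\<in>G. K \<inter> v a \<noteq> {}) \<longrightarrow> K \<in> w G)"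
    using P_fin_neighbourhood w by blast
  then obtain v where v: "\<And>G a. G \<in> nonempty_finite_subsets A \<Longrightarrow> a \<in> G \<Longrightarrow>
        openin X (v G a) \<and> a \<in> v G a"
    and vw: "\<And>G K. G \<in> nonempty_finite_subsets A \<Longrightarrow> K \<in> ?Y \<Longrightarrow> K \<subseteq> (\<Union>a\<in>G. v G a) \<Longrightarrow>
        \<forall>a\<in>G. K \<inter> v G a \<noteq> {} \<Longrightarrow> K \<in> w G"
    by metis
  define S where "S a = {G \<in> nonempty_finite_subsets A. a \<in> G}" for a
  define u where "u a = (\<Inter>G\<in>S a. v G a)" for a
  have "finite (nonempty_finite_subsets A)"
    using A by (auto simp: nonempty_finite_subsets_def)
  then have S: "finite (S a)" for a
    by (simp add: S_def)
  have u: "openin X (u a)" "a \<in> u a" if "a \<in> A" for a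
  proof -
    have "{a} \<in> S a" using that by (auto simp: S_def nonempty_finite_subsets_def)
    then show "openin X (u a)"
      unfolding u_def using S v by (intro openin_INT2) (auto simp: S_def)
    show "a \<in> u a" using v by (auto simp: u_def S_def)
  qed
  show thesis
  proof
    show "openin X (\<Union>a\<in>A. u a)" using u by blast
    show "A \<subseteq> (\<Union>a\<in>A. u a)" using u by blast
    show "box_P_fin X (\<Union>a\<in>A. u a) \<subseteq> (\<Union>G\<in>nonempty_finite_subsets A. w G)"
    proof
      fix K assume "K \<in> box_P_fin X (\<Union>a\<in>A. u a)"
      then have K: "K \<in> ?Y" "K \<subseteq> (\<Union>a\<in>A. u a)" by (auto simp: box_P_fin_def)
      define G where "G = {a \<in> A. K \<inter> u a \<noteq> {}}"
      have KG: "K \<subseteq> (\<Union>a\<in>G. u a)" using K(2) unfolding G_def by blast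
      have "K \<noteq> {}" "finite A" using K(1) A by (auto simp: nonempty_finite_subsets_def)
      then have G: "G \<in> nonempty_finite_subsets A"
        using KG by (intro nonempty_finite_subsetsI) (auto simp: G_def)
      have uv: "u a \<subseteq> v G a" if "a \<in> G" for a
        using that G unfolding u_def S_def by blast
      have "\<forall>a\<in>G. K \<inter> u a \<noteq> {}" by (simp add: G_def)
      then have "\<forall>a\<in>G. K \<inter> v G a \<noteq> {}" using uv by blast
      moreover have "K \<subseteq> (\<Union>a\<in>G. v G a)"
        using KG UN_mono[OF order_refl uv] by (rule order_trans)
      ultimately have "K \<in> w G"
        using vw[OF G K(1)] by blast
      then show "K \<in> (\<Union>G\<in>nonempty_finite_subsets A. w G)"
        using G by blast
    qed
  qed
qed

lemma Hurewicz_P_fin_if_omega_Hurewicz: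
  assumes "omega_Hurewicz X" "t1_space X" "infinite (topspace X)"
  shows "Hurewicz (P_fin X)"
  unfolding Hurewicz_def
proof (intro allI impI)
  fix \<U> :: "nat \<Rightarrow> 'a set set set"
  assume \<U>: "\<forall>n. \<U> n \<in> open_covers (P_fin X)"
  let ?Y = "nonempty_finite_subsets (topspace X)"
  have "\<exists>F. (\<forall>n. F n \<in> nonempty_finite_subsets (\<U> n)) \<and> (\<forall>A \<in> ?Y.
      \<exists>m. \<forall>n\<ge>m. \<exists>V \<G>. A \<subseteq> V \<and> \<G> \<subseteq> F n \<and> box_P_fin X V \<subseteq> \<Union>\<G>)"
  proof (rule omega_Hurewicz_select_witnesses[OF assms])
    fix n A assume A: "A \<in> nonempty_finite_subsets (topspace X)"
    have "\<exists>W. W \<in> \<U> n \<and> G \<in> W" if "G \<in> nonempty_finite_subsets A" for G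
    proof -
      have "G \<in> topspace (P_fin X)"
        using that A by (auto simp: topspace_P_fin nonempty_finite_subsets_def)
      moreover have "\<Union>(\<U> n) = topspace (P_fin X)"
        using \<U> by (simp add: open_covers_def)
      ultimately show ?thesis by (metis UnionE)
    qed
    then obtain w where w: "\<And>G. G \<in> nonempty_finite_subsets A \<Longrightarrow> w G \<in> \<U> n \<and> G \<in> w G"
      by metis
    have "openin (P_fin X) (w G) \<and> G \<in> w G" if "G \<in> nonempty_finite_subsets A" for G
      using w[OF that] \<U> by (auto simp: open_covers_def nontrivial_opens_def)
    from P_fin_tube[OF A this] obtain V where V: "openin X V" "A \<subseteq> V"
        "box_P_fin X V \<subseteq> \<Union>(w ` nonempty_finite_subsets A)" .
    have "A \<in> nonempty_finite_subsets A" "finite (nonempty_finite_subsets A)"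
      using A by (auto simp: nonempty_finite_subsets_def)
    then have "w ` nonempty_finite_subsets A \<in> nonempty_finite_subsets (\<U> n)"
      using w by (intro nonempty_finite_subsetsI) auto
    then show "\<exists>V \<G>. openin X V \<and> A \<subseteq> V \<and> \<G> \<in> nonempty_finite_subsets (\<U> n) \<and>
        box_P_fin X V \<subseteq> \<Union>\<G>"
      using V by blast
  next
    fix V V' :: "'a set" and \<G> :: "'a set set set"
    assume "box_P_fin X V \<subseteq> \<Union>\<G>" "V' \<subseteq> V"
    then show "box_P_fin X V' \<subseteq> \<Union>\<G>"
      using box_P_fin_mono by (meson order_trans)
  qed
  then obtain F where F: "\<forall>n. F n \<in> nonempty_finite_subsets (\<U> n)"
    and cap: "\<forall>A \<in> ?Y.
      \<exists>m. \<forall>n\<ge>m. \<exists>V \<G>. A \<subseteq> V \<and> \<G> \<subseteq> F n \<and> box_P_fin X V \<subseteq> \<Union>\<G>"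
    by blast
  have "\<exists>m. \<forall>n\<ge>m. K \<in> \<Union>(F n)" if "K \<in> topspace (P_fin X)" for K
  proof -
    have K: "K \<in> ?Y" using that by (simp add: topspace_P_fin)
    then have "K \<in> box_P_fin X V" if "K \<subseteq> V" for V
      using that by (simp add: box_P_fin_def)
    then show ?thesis using bspec[OF cap K] by (meson Union_iff subsetD)
  qed
  then show "\<exists>\<F>. (\<forall>n. \<F> n \<in> nonempty_finite_subsets (\<U> n)) \<and>
      (\<forall>z\<in>topspace (P_fin X). \<exists>m. \<forall>n\<ge>m. z \<in> \<Union>(\<F> n))"
    using F by blast
qed

text \<open>Here one member of the omega-cover contains all nonempty subsets of \<open>A\<close> at once, and a finite
  family of finite sets is captured as soon as its union is.\<close>

lemma omega_Hurewicz_P_fin_if_omega_Hurewicz: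
  assumes "omega_Hurewicz X" "t1_space X" "infinite (topspace X)"
  shows "omega_Hurewicz (P_fin X)"
  unfolding omega_Hurewicz_def
proof (intro allI impI)
  fix \<U> :: "nat \<Rightarrow> 'a set set set"
  assume \<U>: "\<forall>n. \<U> n \<in> omega_covers (P_fin X)"
  let ?Y = "nonempty_finite_subsets (topspace X)"
  have "\<exists>F. (\<forall>n. F n \<in> nonempty_finite_subsets (\<U> n)) \<and> (\<forall>A \<in> ?Y.
      \<exists>m. \<forall>n\<ge>m. \<exists>V \<G>. A \<subseteq> V \<and> \<G> \<subseteq> F n \<and> (\<exists>W\<in>\<G>. box_P_fin X V \<subseteq> W))"
  proof (rule omega_Hurewicz_select_witnesses[OF assms])
    fix n A assume A: "A \<in> nonempty_finite_subsets (topspace X)"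
    have "nonempty_finite_subsets A \<in> nonempty_finite_subsets (topspace (P_fin X))"
      using A unfolding topspace_P_fin by (auto simp: nonempty_finite_subsets_def)
    then obtain W where W: "W \<in> \<U> n" "nonempty_finite_subsets A \<subseteq> W"
      using \<U> omega_covers_capture by metis
    have "openin (P_fin X) W \<and> G \<in> W" if "G \<in> nonempty_finite_subsets A" for G
      using W that \<U> omega_covers_nontrivial by (fastforce simp: nontrivial_opens_def)
    from P_fin_tube[OF A this] obtain V
      where "openin X V" "A \<subseteq> V" "box_P_fin X V \<subseteq> (\<Union>G\<in>nonempty_finite_subsets A. W)" .
    then have V: "openin X V" "A \<subseteq> V" "box_P_fin X V \<subseteq> W" by blast+
    have "{W} \<in> nonempty_finite_subsets (\<U> n)"
      using W by (simp add: nonempty_finite_subsets_def)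
    then show "\<exists>V \<G>. openin X V \<and> A \<subseteq> V \<and> \<G> \<in> nonempty_finite_subsets (\<U> n) \<and>
        (\<exists>W\<in>\<G>. box_P_fin X V \<subseteq> W)"
      using V by blast
  next
    fix V V' :: "'a set" and \<G> :: "'a set set set"
    assume "\<exists>W\<in>\<G>. box_P_fin X V \<subseteq> W" "V' \<subseteq> V"
    moreover from this have "box_P_fin X V' \<subseteq> box_P_fin X V"
      by (simp add: box_P_fin_mono)
    ultimately show "\<exists>W\<in>\<G>. box_P_fin X V' \<subseteq> W" by blast
  qed
  then obtain F where F: "\<forall>n. F n \<in> nonempty_finite_subsets (\<U> n)"
    and cap: "\<forall>A \<in> ?Y.
      \<exists>m. \<forall>n\<ge>m. \<exists>V \<G>. A \<subseteq> V \<and> \<G> \<subseteq> F n \<and> (\<exists>W\<in>\<G>. box_P_fin X V \<subseteq> W)"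
    by blast
  have "\<exists>m. \<forall>n\<ge>m. \<exists>W\<in>F n. \<A> \<subseteq> W"
    if \<A>: "\<A> \<in> nonempty_finite_subsets (topspace (P_fin X))" for \<A>
  proof -
    have \<A>Y: "\<A> \<subseteq> ?Y" using \<A> nonempty_finite_subsetsD(1) topspace_P_fin by metis
    then have "\<Union>\<A> \<in> ?Y"
      using nonempty_finite_subsetsD(2,3)[OF \<A>]
      by (fastforce simp: nonempty_finite_subsets_def)
    then obtain m where m: "\<And>n. n \<ge> m \<Longrightarrow>
        \<exists>V \<G>. \<Union>\<A> \<subseteq> V \<and> \<G> \<subseteq> F n \<and> (\<exists>W\<in>\<G>. box_P_fin X V \<subseteq> W)"
      using cap by blast
    have "\<exists>W\<in>F n. \<A> \<subseteq> W" if n: "n \<ge> m" for n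
    proof -
      obtain V W where "\<Union>\<A> \<subseteq> V" "W \<in> F n" "box_P_fin X V \<subseteq> W"
        using m[OF n] by (meson subsetD)
      moreover from this have "\<A> \<subseteq> box_P_fin X V"
        using \<A>Y by (auto simp: box_P_fin_def)
      ultimately show ?thesis by blast
    qed
    then show ?thesis by blast
  qed
  then show "\<exists>\<F>. (\<forall>n. \<F> n \<in> nonempty_finite_subsets (\<U> n)) \<and>
      (\<forall>A\<in>nonempty_finite_subsets (topspace (P_fin X)). \<exists>m. \<forall>n\<ge>m. \<exists>U\<in>\<F> n. A \<subseteq> U)"
    using F by blast
qed

lemma omega_Hurewicz_if_Hurewicz_P_fin:
  assumes "Hurewicz (P_fin X)"
  shows "omega_Hurewicz X"
  unfolding omega_Hurewicz_def
proof (intro allI impI)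
  fix \<U> :: "nat \<Rightarrow> 'a set set"
  assume \<U>: "\<forall>n. \<U> n \<in> omega_covers X"
  have nontriv: "box_P_fin X U \<in> nontrivial_opens (P_fin X)" if "U \<in> \<U> n" for n U
    using box_P_fin_nontrivial omega_covers_nontrivial \<U> that by blast
  have cover: "\<exists>U\<in>\<U> n. K \<in> box_P_fin X U" if "K \<in> topspace (P_fin X)" for n K
    using that \<U> omega_covers_capture unfolding topspace_P_fin box_P_fin_def
    by (metis mem_Collect_eq)
  have "\<exists>F. (\<forall>n. F n \<in> nonempty_finite_subsets (\<U> n)) \<and>
      (\<forall>K \<in> topspace (P_fin X). \<exists>m. \<forall>n\<ge>m. \<exists>U\<in>F n. K \<in> box_P_fin X U)"
    by (rule Hurewicz_select_through[OF assms]) (erule nontriv, erule cover)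
  then obtain F where F: "\<forall>n. F n \<in> nonempty_finite_subsets (\<U> n)"
    and cap: "\<forall>K \<in> topspace (P_fin X). \<exists>m. \<forall>n\<ge>m. \<exists>U\<in>F n. K \<in> box_P_fin X U"
    by blast
  have "\<exists>m. \<forall>n\<ge>m. \<exists>U\<in>F n. A \<subseteq> U" if "A \<in> nonempty_finite_subsets (topspace X)" for A
    using bspec[OF cap, of A] that by (simp add: topspace_P_fin box_P_fin_def)
  then show "\<exists>\<F>. (\<forall>n. \<F> n \<in> nonempty_finite_subsets (\<U> n)) \<and>
      (\<forall>A\<in>nonempty_finite_subsets (topspace X). \<exists>m. \<forall>n\<ge>m. \<exists>U\<in>\<F> n. A \<subseteq> U)"
    using F by blast
qed

lemma omega_Hurewicz_if_omega_Hurewicz_P_fin: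
  assumes H: "omega_Hurewicz (P_fin X)"
  shows "omega_Hurewicz X"
  unfolding omega_Hurewicz_def
proof (intro allI impI)
  fix \<U> :: "nat \<Rightarrow> 'a set set"
  assume \<U>: "\<forall>n. \<U> n \<in> omega_covers X"
  have "box_P_fin X ` \<U> n \<in> omega_covers (P_fin X)" for n
  proof (rule omega_coversI)
    show "box_P_fin X ` \<U> n \<subseteq> nontrivial_opens (P_fin X)"
      using box_P_fin_nontrivial omega_covers_nontrivial \<U> by blast
    fix \<A> assume \<A>: "\<A> \<in> nonempty_finite_subsets (topspace (P_fin X))"
    have \<A>Y: "\<A> \<subseteq> nonempty_finite_subsets (topspace X)"
      using \<A> nonempty_finite_subsetsD(1) topspace_P_fin by metis
    then have "\<Union>\<A> \<in> nonempty_finite_subsets (topspace X)"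
      using nonempty_finite_subsetsD(2,3)[OF \<A>]
      by (fastforce simp: nonempty_finite_subsets_def)
    then obtain U where "U \<in> \<U> n" "\<Union>\<A> \<subseteq> U"
      using \<U> omega_covers_capture by metis
    moreover from this have "\<A> \<subseteq> box_P_fin X U"
      using \<A>Y by (auto simp: box_P_fin_def)
    ultimately show "\<exists>W\<in>box_P_fin X ` \<U> n. \<A> \<subseteq> W" by blast
  qed
  then obtain E where E: "\<And>n. E n \<in> nonempty_finite_subsets (box_P_fin X ` \<U> n)"
    and cap: "\<And>\<A>. \<A> \<in> nonempty_finite_subsets (topspace (P_fin X)) \<Longrightarrow>
        \<exists>m. \<forall>n\<ge>m. \<exists>W\<in>E n. \<A> \<subseteq> W"
    using omega_Hurewicz_select[OF H, of "\<lambda>n. box_P_fin X ` \<U> n"] by metis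
  have "\<exists>F. F \<in> nonempty_finite_subsets (\<U> n) \<and> E n = box_P_fin X ` F" for n
    using nonempty_finite_subsetsD[OF E[of n]]
    by (metis finite_subset_image image_empty nonempty_finite_subsetsI)
  then obtain F where F: "\<And>n. F n \<in> nonempty_finite_subsets (\<U> n)"
      "\<And>n. E n = box_P_fin X ` F n"
    by metis
  have "\<exists>m. \<forall>n\<ge>m. \<exists>U\<in>F n. A \<subseteq> U" if "A \<in> nonempty_finite_subsets (topspace X)" for A
    using cap[of "{A}"] that F(2)
    by (simp add: nonempty_finite_subsets_def topspace_P_fin box_P_fin_def)
  then show "\<exists>\<F>. (\<forall>n. \<F> n \<in> nonempty_finite_subsets (\<U> n)) \<and>
      (\<forall>A\<in>nonempty_finite_subsets (topspace X). \<exists>m. \<forall>n\<ge>m. \<exists>U\<in>\<F> n. A \<subseteq> U)"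
    using F by blast
qed

section \<open>Finite powers\<close>

text \<open>The tube lemma for the finite set of tuples with entries in \<open>A\<close>.\<close>

lemma power_tube:
  fixes k :: nat
  assumes A: "finite A" "A \<subseteq> topspace X"
    and w: "\<And>x. x \<in> ({..<k} \<rightarrow>\<^sub>E A) \<Longrightarrow>
      openin (product_topology (\<lambda>_. X) {..<k}) (w x) \<and> x \<in> w x"
  obtains V where "openin X V" "A \<subseteq> V"
    "({..<k} \<rightarrow>\<^sub>E V) \<subseteq> (\<Union>x\<in>{..<k} \<rightarrow>\<^sub>E A. w x)"
proof -
  let ?P = "{..<k} \<rightarrow>\<^sub>E A"
  have "\<forall>x\<in>?P. \<exists>v. (\<forall>i. openin X (v i)) \<and> x \<in> Pi\<^sub>E {..<k} v \<and> Pi\<^sub>E {..<k} v \<subseteq> w x"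
  proof
    fix x assume "x \<in> ?P"
    then have "openin (product_topology (\<lambda>_. X) {..<k}) (w x)" "x \<in> w x" using w by auto
    from product_topology_open_contains_basis[OF this] show "\<exists>v. (\<forall>i. openin X (v i)) \<and>
        x \<in> Pi\<^sub>E {..<k} v \<and> Pi\<^sub>E {..<k} v \<subseteq> w x"
      by blast
  qed
  then obtain v where v: "\<And>x i. x \<in> ?P \<Longrightarrow> openin X (v x i)"
      "\<And>x. x \<in> ?P \<Longrightarrow> x \<in> Pi\<^sub>E {..<k} (v x)" "\<And>x. x \<in> ?P \<Longrightarrow> Pi\<^sub>E {..<k} (v x) \<subseteq> w x"
    by metis
  define S where "S a = {(x, i). x \<in> ?P \<and> i < k \<and> x i = a}" for a
  define u where "u a = topspace X \<inter> (\<Inter>(x, i)\<in>S a. v x i)" for a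
  have "finite (?P \<times> {..<k})" using A by (simp add: finite_PiE)
  then have fS: "finite (S a)" for a
    by (rule rev_finite_subset) (auto simp: S_def)
  have u: "openin X (u a)" for a
  proof (cases "S a = {}")
    case False
    then have "openin X (\<Inter>(x, i)\<in>S a. v x i)"
      using v(1) fS by (intro openin_INT2) (auto simp: S_def)
    then show ?thesis by (simp add: u_def openin_Int)
  qed (simp add: u_def)
  have au: "a \<in> u a" if "a \<in> A" for a
    using that A v(2) by (fastforce simp: u_def S_def PiE_iff)
  show thesis
  proof
    show "openin X (\<Union>a\<in>A. u a)" using u by blast
    show "A \<subseteq> (\<Union>a\<in>A. u a)" using au by blast
    show "({..<k} \<rightarrow>\<^sub>E (\<Union>a\<in>A. u a)) \<subseteq> (\<Union>x\<in>?P. w x)"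
    proof
      fix y assume y: "y \<in> {..<k} \<rightarrow>\<^sub>E (\<Union>a\<in>A. u a)"
      then have "\<forall>i\<in>{..<k}. \<exists>a. a \<in> A \<and> y i \<in> u a" by (auto simp: PiE_iff)
      then obtain x where x: "\<And>i. i < k \<Longrightarrow> x i \<in> A \<and> y i \<in> u (x i)"
        by (metis lessThan_iff)
      define x' where "x' = restrict x {..<k}"
      have x': "x' \<in> ?P" using x by (auto simp: x'_def)
      have "y i \<in> v x' i" if "i < k" for i
      proof -
        have "(x', i) \<in> S (x i)" using x' that by (simp add: S_def x'_def)
        then show ?thesis using x[OF that] by (auto simp: u_def)
      qed
      then have "y \<in> Pi\<^sub>E {..<k} (v x')" using y by (auto simp: PiE_iff)
      then show "y \<in> (\<Union>x\<in>?P. w x)" using v(3) x' by blast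
    qed
  qed
qed

lemma Hurewicz_power_if_omega_Hurewicz:
  fixes k :: nat
  assumes "omega_Hurewicz X" "t1_space X" "infinite (topspace X)" and "k \<ge> 1"
  shows "Hurewicz (product_topology (\<lambda>_. X) {..<k})"
  unfolding Hurewicz_def
proof (intro allI impI)
  let ?Z = "product_topology (\<lambda>_. X) {..<k}"
  fix \<U> :: "nat \<Rightarrow> (nat \<Rightarrow> 'a) set set"
  assume \<U>: "\<forall>n. \<U> n \<in> open_covers ?Z"
  have "\<exists>F. (\<forall>n. F n \<in> nonempty_finite_subsets (\<U> n)) \<and> (\<forall>A \<in> nonempty_finite_subsets (topspace X).
      \<exists>m. \<forall>n\<ge>m. \<exists>V \<G>. A \<subseteq> V \<and> \<G> \<subseteq> F n \<and> ({..<k} \<rightarrow>\<^sub>E V) \<subseteq> \<Union>\<G>)"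
  proof (rule omega_Hurewicz_select_witnesses[OF assms(1-3)])
    fix n A assume A: "A \<in> nonempty_finite_subsets (topspace X)"
    let ?P = "{..<k} \<rightarrow>\<^sub>E A"
    have A': "finite A" "A \<subseteq> topspace X" "A \<noteq> {}"
      using nonempty_finite_subsetsD[OF A] by auto
    have "\<exists>W. W \<in> \<U> n \<and> x \<in> W" if "x \<in> ?P" for x
    proof -
      have "x \<in> topspace ?Z" using that A' by (auto simp: PiE_iff)
      moreover have "\<Union>(\<U> n) = topspace ?Z"
        using \<U> by (simp add: open_covers_def)
      ultimately show ?thesis by (metis UnionE)
    qed
    then obtain w where w: "\<And>x. x \<in> ?P \<Longrightarrow> w x \<in> \<U> n \<and> x \<in> w x"
      by metis
    have "openin ?Z (w x) \<and> x \<in> w x" if "x \<in> ?P" for x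
      using w[OF that] \<U> by (auto simp: open_covers_def nontrivial_opens_def)
    from power_tube[OF A'(1,2) this] obtain V where V: "openin X V" "A \<subseteq> V"
        "({..<k} \<rightarrow>\<^sub>E V) \<subseteq> \<Union>(w ` ?P)" .
    have "finite ?P" "?P \<noteq> {}"
      using A' by (auto simp: finite_PiE PiE_eq_empty_iff)
    then have "w ` ?P \<in> nonempty_finite_subsets (\<U> n)"
      using w by (intro nonempty_finite_subsetsI) auto
    then show "\<exists>V \<G>. openin X V \<and> A \<subseteq> V \<and> \<G> \<in> nonempty_finite_subsets (\<U> n) \<and>
        ({..<k} \<rightarrow>\<^sub>E V) \<subseteq> \<Union>\<G>"
      using V by blast
  next
    fix V V' :: "'a set" and \<G> :: "(nat \<Rightarrow> 'a) set set"
    assume "({..<k} \<rightarrow>\<^sub>E V) \<subseteq> \<Union>\<G>" "V' \<subseteq> V"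
    then show "({..<k} \<rightarrow>\<^sub>E V') \<subseteq> \<Union>\<G>"
      using PiE_mono[of "{..<k}" "\<lambda>_. V'" "\<lambda>_. V"] by blast
  qed
  then obtain F where F: "\<forall>n. F n \<in> nonempty_finite_subsets (\<U> n)"
    and cap: "\<forall>A \<in> nonempty_finite_subsets (topspace X).
      \<exists>m. \<forall>n\<ge>m. \<exists>V \<G>. A \<subseteq> V \<and> \<G> \<subseteq> F n \<and> ({..<k} \<rightarrow>\<^sub>E V) \<subseteq> \<Union>\<G>"
    by blast
  have "\<exists>m. \<forall>n\<ge>m. z \<in> \<Union>(F n)" if "z \<in> topspace ?Z" for z
  proof -
    have z: "z \<in> {..<k} \<rightarrow>\<^sub>E topspace X" using that by simp
    then have "z ` {..<k} \<in> nonempty_finite_subsets (topspace X)"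
      using \<open>k \<ge> 1\<close> by (intro nonempty_finite_subsetsI) (auto simp: PiE_iff lessThan_empty_iff)
    from bspec[OF cap this] obtain m where m: "\<And>n. n \<ge> m \<Longrightarrow>
        \<exists>V \<G>. z ` {..<k} \<subseteq> V \<and> \<G> \<subseteq> F n \<and> ({..<k} \<rightarrow>\<^sub>E V) \<subseteq> \<Union>\<G>"
      by blast
    have "z \<in> {..<k} \<rightarrow>\<^sub>E V" if "z ` {..<k} \<subseteq> V" for V
      using z that by (auto simp: PiE_iff)
    then show ?thesis using m by (meson Union_iff subsetD)
  qed
  then show "\<exists>\<F>. (\<forall>n. \<F> n \<in> nonempty_finite_subsets (\<U> n)) \<and>
      (\<forall>z\<in>topspace ?Z. \<exists>m. \<forall>n\<ge>m. z \<in> \<Union>(\<F> n))"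
    using F by blast
qed

text \<open>A set of \<open>k\<close> points is the range of a point of the \<open>k\<close>-th power. Taking at stage \<open>n\<close> the union of
  the selections for the powers with exponent at most \<open>n + 1\<close> serves all finite sets at once.\<close>

lemma omega_Hurewicz_if_Hurewicz_powers:
  assumes H: "\<And>k::nat. k \<ge> 1 \<Longrightarrow> Hurewicz (product_topology (\<lambda>_. X) {..<k})"
  shows "omega_Hurewicz X"
  unfolding omega_Hurewicz_def
proof (intro allI impI)
  fix \<U> :: "nat \<Rightarrow> 'a set set"
  assume \<U>: "\<forall>n. \<U> n \<in> omega_covers X"
  have "\<exists>F. (\<forall>n. F n \<in> nonempty_finite_subsets (\<U> n)) \<and>
      (\<forall>z \<in> {..<Suc k} \<rightarrow>\<^sub>E topspace X. \<exists>m. \<forall>n\<ge>m. \<exists>U\<in>F n. z \<in> {..<Suc k} \<rightarrow>\<^sub>E U)" for k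
  proof -
    let ?Z = "product_topology (\<lambda>_. X) {..<Suc k}"
    have nontriv: "({..<Suc k} \<rightarrow>\<^sub>E U) \<in> nontrivial_opens ?Z" if "U \<in> \<U> n" for n U
    proof -
      have U: "openin X U" "U \<noteq> {}" "U \<noteq> topspace X"
        using omega_covers_nontrivial that \<U> by (auto simp: nontrivial_opens_def)
      have "openin ?Z ({..<Suc k} \<rightarrow>\<^sub>E U)"
        by (rule openin_PiE_gen[THEN iffD2]) (use U in auto)
      moreover have "({..<Suc k} \<rightarrow>\<^sub>E U) \<noteq> {}"
        using U(2) by (simp add: PiE_eq_empty_iff)
      moreover have "({..<Suc k} \<rightarrow>\<^sub>E U) \<noteq> topspace ?Z"
        using U by (auto simp: PiE_eq_iff)
      ultimately show ?thesis by (simp add: nontrivial_opens_def)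
    qed
    have cover: "\<exists>U\<in>\<U> n. z \<in> {..<Suc k} \<rightarrow>\<^sub>E U" if "z \<in> topspace ?Z" for n z
    proof -
      have z: "z \<in> {..<Suc k} \<rightarrow>\<^sub>E topspace X" using that by simp
      then have "z ` {..<Suc k} \<in> nonempty_finite_subsets (topspace X)"
        by (intro nonempty_finite_subsetsI) (auto simp: PiE_iff lessThan_empty_iff)
      then obtain U where "U \<in> \<U> n" "z ` {..<Suc k} \<subseteq> U"
        using \<U> omega_covers_capture by metis
      then show ?thesis using z by (auto simp: PiE_iff)
    qed
    have "Hurewicz ?Z" by (rule H) simp
    then have "\<exists>F. (\<forall>n. F n \<in> nonempty_finite_subsets (\<U> n)) \<and>
        (\<forall>z \<in> topspace ?Z. \<exists>m. \<forall>n\<ge>m. \<exists>U\<in>F n. z \<in> {..<Suc k} \<rightarrow>\<^sub>E U)"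
      by (rule Hurewicz_select_through) (erule nontriv, erule cover)
    then show ?thesis by simp
  qed
  then obtain F where F: "\<And>k n. F k n \<in> nonempty_finite_subsets (\<U> n)"
    and cap: "\<And>k z. z \<in> {..<Suc k} \<rightarrow>\<^sub>E topspace X \<Longrightarrow>
        \<exists>m. \<forall>n\<ge>m. \<exists>U\<in>F k n. z \<in> {..<Suc k} \<rightarrow>\<^sub>E U"
    by metis
  have "(\<Union>k\<le>n. F k n) \<in> nonempty_finite_subsets (\<U> n)" for n
  proof (rule nonempty_finite_subsetsI)
    show "(\<Union>k\<le>n. F k n) \<subseteq> \<U> n"
      using nonempty_finite_subsetsD(1)[OF F] by (rule UN_least)
    show "finite (\<Union>k\<le>n. F k n)"
      using nonempty_finite_subsetsD(2)[OF F] by simp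
    show "(\<Union>k\<le>n. F k n) \<noteq> {}"
      using nonempty_finite_subsetsD(3)[OF F] by auto
  qed
  moreover have "\<exists>m. \<forall>n\<ge>m. \<exists>U\<in>(\<Union>k\<le>n. F k n). A \<subseteq> U"
    if A: "A \<in> nonempty_finite_subsets (topspace X)" for A
  proof -
    obtain k where k: "card A = Suc k"
      using nonempty_finite_subsetsD(2,3)[OF A] by (metis card_gt_0_iff gr0_implies_Suc)
    obtain f where f: "f ` {..<Suc k} = A"
      using ex_bij_betw_nat_finite[OF nonempty_finite_subsetsD(2)[OF A]]
      by (metis atLeast0LessThan bij_betw_imp_surj_on k)
    define z where "z = restrict f {..<Suc k}"
    have zA: "z ` {..<Suc k} = A" using f by (simp add: z_def)
    have "z \<in> {..<Suc k} \<rightarrow>\<^sub>E topspace X"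
      using f nonempty_finite_subsetsD(1)[OF A] by (auto simp: z_def)
    from cap[OF this] obtain m where m: "\<And>n. n \<ge> m \<Longrightarrow> \<exists>U\<in>F k n. z \<in> {..<Suc k} \<rightarrow>\<^sub>E U"
      by blast
    have "\<exists>U\<in>(\<Union>k\<le>n. F k n). A \<subseteq> U" if n: "n \<ge> max m k" for n
    proof -
      obtain U where U: "U \<in> F k n" "z \<in> {..<Suc k} \<rightarrow>\<^sub>E U" using m n by auto
      then have "A \<subseteq> U" unfolding zA[symmetric] by (auto simp: PiE_iff)
      then show ?thesis using U(1) n by auto
    qed
    then show ?thesis by blast
  qed
  ultimately show "\<exists>\<F>. (\<forall>n. \<F> n \<in> nonempty_finite_subsets (\<U> n)) \<and>
      (\<forall>A\<in>nonempty_finite_subsets (topspace X). \<exists>m. \<forall>n\<ge>m. \<exists>U\<in>\<F> n. A \<subseteq> U)"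
    by (intro exI[of _ "\<lambda>n. \<Union>k\<le>n. F k n"] conjI allI ballI)
qed

section \<open>The equivalence\<close>

theorem corollary39:
  fixes X :: "'a topology"
  assumes "Hausdorff_space X" and "infinite (topspace X)"
  shows "(Hurewicz (P_fin X) \<longleftrightarrow>
            S_fin (omega_covers (P_fin X)) (groupable (omega_covers (P_fin X)))) \<and>
         (S_fin (omega_covers (P_fin X)) (groupable (omega_covers (P_fin X))) \<longleftrightarrow>
            S_fin (omega_covers X) (groupable (omega_covers X))) \<and>
         (S_fin (omega_covers X) (groupable (omega_covers X)) \<longleftrightarrow>
            (\<forall>n\<ge>1. Hurewicz (product_topology (\<lambda>_. X) {..<n::nat}))) \<and>
         ((\<forall>n\<ge>1. Hurewicz (product_topology (\<lambda>_. X) {..<n::nat})) \<longleftrightarrow>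
            \<not> (\<exists>\<sigma>. winning_strategy_One_G_fin (omega_covers X) (groupable (omega_covers X)) \<sigma>))"
proof -
  have t1: "t1_space X"
    using assms(1) by (rule Hausdorff_imp_t1_space)
  have "Hurewicz (P_fin X) \<longleftrightarrow> omega_Hurewicz X"
    using omega_Hurewicz_if_Hurewicz_P_fin Hurewicz_P_fin_if_omega_Hurewicz[OF _ t1 assms(2)]
    by blast
  moreover have "omega_Hurewicz (P_fin X) \<longleftrightarrow> omega_Hurewicz X"
    using omega_Hurewicz_if_omega_Hurewicz_P_fin
      omega_Hurewicz_P_fin_if_omega_Hurewicz[OF _ t1 assms(2)]
    by blast
  moreover have "(\<forall>n\<ge>1. Hurewicz (product_topology (\<lambda>_. X) {..<n::nat})) \<longleftrightarrow> omega_Hurewicz X"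
    using omega_Hurewicz_if_Hurewicz_powers Hurewicz_power_if_omega_Hurewicz[OF _ t1 assms(2)]
    by blast
  ultimately show ?thesis
    unfolding S_fin_iff_omega_Hurewicz no_winning_strategy_iff_omega_Hurewicz by simp
qed

end
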